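(* Let $r\ge2$ be an integer, let $N$ be an integer, and let $m=\ell_1\cdots\ell_n$ where the $\ell_i$ are distinct primes with $\ell_i\equiv1\pmod r$ and $\ell_i\nmid N$. The set $$P_r(N;m):=\{(x,y)\in(\mathbb Z/m\mathbb Z)^*\times(\mathbb Z/m\mathbb Z)^*:\ xy\equiv N\pmod m,\ x\in((\mathbb Z/m\mathbb Z)^* )^r\}$$ has cardinality $\prod_{i=1}^n\frac{\ell_i-1}{r}=O(m/r^n)$. If $N=u^rv$ with $u,v$ integers, then $(u^r\bmod m,\ v\bmod m)\in P_r(N;m)$.
   Context: $((\mathbb Z/m\mathbb Z)^* )^r=\{t^r:t\in(\mathbb Z/m\mathbb Z)^*\}$ denotes the subgroup of $r$-th powers. The implied constant in $O(\cdot)$ is absolute. *)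

theory Defs
  imports Complex_Main "HOL-Algebra.IntRing" "HOL-Number_Theory.Cong"
begin

(* ZMod m a is the residue class of a in the ring ZFact m = Z/(m).  For m = 1 this is the zero
   ring, whose only element counts as a unit. *)

definition unit_powers :: "nat \<Rightarrow> int \<Rightarrow> int set set" where
  "unit_powers r m = {t [^]\<^bsub>ZFact m\<^esub> r | t. t \<in> Units (ZFact m)}"

definition P_r :: "nat \<Rightarrow> int \<Rightarrow> int \<Rightarrow> (int set \<times> int set) set" where
  "P_r r N m = {(x, y) \<in> Units (ZFact m) \<times> Units (ZFact m).
      x \<otimes>\<^bsub>ZFact m\<^esub> y = ZMod m N \<and> x \<in> unit_powers r m}"

end

theory Submission
  imports Defs "HOL-Number_Theory.Residue_Primitive_Roots"
begin

text \<open>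
  Since \<open>N\<close> is prime to \<open>m\<close>, it is a unit modulo \<open>m\<close>, so a pair \<open>(x, y)\<close> with \<open>x y = N\<close> is
  determined by \<open>x\<close>, which may be any \<open>r\<close>-th power of a unit.  The cardinality sought is therefore
  the number of \<open>r\<close>-th powers of units (\<open>card_P_r\<close>).  By the Chinese remainder theorem a residue
  modulo \<open>m = l\<^sub>1 \<cdots> l\<^sub>n\<close> is an \<open>r\<close>-th power of a unit exactly when it is one modulo
  every \<open>l\<^sub>i\<close>, so this number is the product of its values at the \<open>l\<^sub>i\<close>
  (\<open>card_power_residues_prod\<close>).  Modulo a prime \<open>p\<close> the units are the powers of a primitive root
  \<open>g\<close>, and when \<open>r\<close> divides \<open>p - 1\<close> the \<open>r\<close>-th powers form the subgroup generated by
  \<open>g ^ r\<close>, of order \<open>(p - 1) / r\<close> (\<open>card_power_residues_prime\<close>).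

  Counting takes place among the integers in \<open>{0..<m}\<close>; the map \<open>ZMod m\<close> carries the result over
  to the quotient ring.  The bound holds with constant \<open>1\<close>, as each factor \<open>l\<^sub>i - 1\<close> is at most
  \<open>l\<^sub>i\<close>.
\<close>

section \<open>Residues that are powers of units\<close>

definition power_residues :: "nat \<Rightarrow> int \<Rightarrow> int set" where
  "power_residues r m = {t ^ r mod m | t. coprime t m}"

lemma finite_power_residues:
  assumes "m > 0"
  shows "finite (power_residues r m)"
proof (rule finite_subset)
  show "power_residues r m \<subseteq> {0..<m}"
    using assms by (auto simp: power_residues_def)
qed simp

text \<open>
  Reduction sends \<open>t ^ r\<close> to \<open>t ^ r\<close>, and conversely the bases of two powers, one modulo \<open>a\<close>
  and one modulo \<open>b\<close>, lift to a common base.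
\<close>

lemma bij_betw_power_residues_mult:
  fixes a b :: int
  assumes "coprime a b"
  shows "bij_betw (\<lambda>x. (x mod a, x mod b)) (power_residues r (a * b))
           (power_residues r a \<times> power_residues r b)"
proof (rule bij_betwI')
  fix x y
  assume "x \<in> power_residues r (a * b)" "y \<in> power_residues r (a * b)"
  then have reduced: "x mod (a * b) = x" "y mod (a * b) = y"
    by (auto simp: power_residues_def)
  show "((x mod a, x mod b) = (y mod a, y mod b)) = (x = y)"
  proof
    assume "(x mod a, x mod b) = (y mod a, y mod b)"
    then have "[x = y] (mod a)" "[x = y] (mod b)"
      by (auto simp: cong_def)
    then have "[x = y] (mod (a * b))"
      using assms by (rule coprime_cong_mult)
    then show "x = y"
      by (simp add: cong_def reduced)
  qed simp
next
  fix x
  assume "x \<in> power_residues r (a * b)"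
  then obtain t where "x = t ^ r mod (a * b)" "coprime t (a * b)"
    by (auto simp: power_residues_def)
  then show "(x mod a, x mod b) \<in> power_residues r a \<times> power_residues r b"
    by (auto simp: power_residues_def mod_mod_cancel)
next
  fix z
  assume "z \<in> power_residues r a \<times> power_residues r b"
  then obtain s t where z: "z = (s ^ r mod a, t ^ r mod b)" and st: "coprime s a" "coprime t b"
    by (auto simp: power_residues_def)
  obtain u where u: "[u = s] (mod a)" "[u = t] (mod b)"
    using binary_chinese_remainder_int[OF assms] by blast
  have "coprime u a" "coprime u b"
    using u st by (metis cong_imp_coprime cong_sym)+
  then have "u ^ r mod (a * b) \<in> power_residues r (a * b)"
    by (auto simp: power_residues_def)
  moreover have "z = (u ^ r mod (a * b) mod a, u ^ r mod (a * b) mod b)"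
    using cong_pow[OF u(1), of r] cong_pow[OF u(2), of r]
    by (simp add: z mod_mod_cancel cong_def)
  ultimately show "\<exists>x\<in>power_residues r (a * b). z = (x mod a, x mod b)"
    by blast
qed

lemma card_power_residues_prod:
  fixes p :: "'a \<Rightarrow> int"
  assumes "finite A"
    and "\<And>i j. i \<in> A \<Longrightarrow> j \<in> A \<Longrightarrow> i \<noteq> j \<Longrightarrow> coprime (p i) (p j)"
  shows "card (power_residues r (\<Prod>i\<in>A. p i)) = (\<Prod>i\<in>A. card (power_residues r (p i)))"
  using assms
proof (induction A rule: finite_induct)
  case empty
  have "power_residues r 1 = {0}"
    by (auto simp: power_residues_def)
  then show ?case
    by simp
next
  case (insert i A)
  have "coprime (p i) (\<Prod>j\<in>A. p j)"
    using insert.hyps insert.prems by (intro prod_coprime_right) auto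
  then have "card (power_residues r (p i * (\<Prod>j\<in>A. p j)))
      = card (power_residues r (p i)) * card (power_residues r (\<Prod>j\<in>A. p j))"
    using bij_betw_same_card[OF bij_betw_power_residues_mult]
    by (simp add: card_cartesian_product)
  then show ?case
    using insert by simp
qed

text \<open>
  For a primitive root \<open>g\<close> and \<open>p - 1 = r k\<close>, the powers \<open>g ^ (r i)\<close> with \<open>i < k\<close> run once
  through the \<open>r\<close>-th powers, because exponents of \<open>g\<close> matter modulo \<open>r k\<close>.
\<close>

lemma card_power_residues_prime:
  fixes p :: int
  assumes "prime p" and "[p = 1] (mod int r)"
  shows "int r * int (card (power_residues r p)) = p - 1"
proof -
  have "p > 1"
    using assms(1) by (rule prime_gt_1_int)
  define q where "q = nat p"
  have p: "p = int q" and q: "q > 1"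
    using \<open>p > 1\<close> by (auto simp: q_def)
  have "prime q"
    using assms(1) by (simp add: p)
  have "int r dvd int (q - 1)"
    using assms(2) q by (simp add: p cong_iff_dvd_diff of_nat_diff)
  then obtain k where k: "q - 1 = r * k"
    unfolding int_dvd_int_iff by (elim dvdE)
  have "r > 0" "k > 0"
    using k q by (auto intro!: Nat.gr0I)
  obtain g where g: "residue_primroot q g"
    using prime_primitive_root_exists[of q] \<open>prime q\<close> q by auto
  have copg: "coprime q g" and ordg: "ord q g = r * k"
    using g \<open>prime q\<close> k by (auto simp: residue_primroot_def totient_prime)
  define h where "h = (\<lambda>i. int (g ^ (r * i) mod q))"
  have h_eq: "h i = h j \<longleftrightarrow> [i = j] (mod k)" for i j
  proof -
    have "h i = h j \<longleftrightarrow> [g ^ (r * i) = g ^ (r * j)] (mod q)"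
      by (simp add: h_def cong_def flip: of_nat_mod)
    also have "\<dots> \<longleftrightarrow> [r * i = r * j] (mod (r * k))"
      by (simp add: order_divides_expdiff[OF copg] ordg)
    also have "\<dots> \<longleftrightarrow> [i = j] (mod k)"
      using \<open>r > 0\<close> by (simp add: cong_def)
    finally show ?thesis .
  qed
  have "inj_on h {..<k}"
    by (auto simp: inj_on_def h_eq cong_def)
  moreover have "h ` {..<k} = power_residues r p"
  proof (intro equalityI subsetI)
    fix x
    assume "x \<in> h ` {..<k}"
    then obtain i where "x = h i"
      by blast
    then have "x = (int g ^ i) ^ r mod p"
      by (simp add: h_def p of_nat_mod power_mult[symmetric] mult.commute)
    moreover have "coprime (int g ^ i) p"
      using copg by (simp add: p coprime_commute)
    ultimately show "x \<in> power_residues r p"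
      by (auto simp: power_residues_def)
  next
    fix x
    assume "x \<in> power_residues r p"
    then obtain t where x: "x = t ^ r mod p" and "coprime t p"
      by (auto simp: power_residues_def)
    define s where "s = nat (t mod p)"
    have s: "int s = t mod p"
      using \<open>p > 1\<close> by (simp add: s_def)
    have "coprime (int s) p"
      using \<open>coprime t p\<close> \<open>p > 1\<close> by (simp add: s)
    then have "coprime s q"
      by (simp add: p)
    moreover have "s < q"
      using s \<open>p > 1\<close> p by (metis of_nat_less_iff pos_mod_bound less_trans zero_less_one)
    moreover have "s > 0"
      using \<open>coprime s q\<close> q by (intro Nat.gr0I) auto
    ultimately have "s \<in> totatives q"
      by (simp add: totatives_def)
    then obtain j where j: "s = g ^ j mod q"
      using residue_primroot_is_generator[OF q g] by (auto simp: bij_betw_def)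
    have "x = int s ^ r mod p"
      by (simp add: x s power_mod)
    also have "\<dots> = h j"
      by (simp add: h_def j p of_nat_mod power_mod power_mult[symmetric] mult.commute)
    also have "\<dots> = h (j mod k)"
      by (simp add: h_eq cong_def)
    finally show "x \<in> h ` {..<k}"
      using \<open>k > 0\<close> by auto
  qed
  ultimately have "card (power_residues r p) = k"
    by (metis card_image card_lessThan)
  then show ?thesis
    using k q p by (simp flip: of_nat_mult)
qed

section \<open>Arithmetic of residue classes\<close>

lemma ZFact_carrier: "carrier (ZFact m) = range (ZMod m)"
  by (auto simp: ZFact_defs ZMod_def A_RCOSETS_def' image_def)

lemma ZFact_mult: "ZMod m a \<otimes>\<^bsub>ZFact m\<^esub> ZMod m b = ZMod m (a * b)"
proof -
  interpret ideal "Idl\<^bsub>\<Z>\<^esub> {m}" \<Z>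
    by (rule int.genideal_ideal) simp
  show ?thesis
    using rcoset_mult_add[of a b] by (simp add: ZFact_defs ZMod_def)
qed

lemma ZFact_one_class: "\<one>\<^bsub>ZFact m\<^esub> = ZMod m 1"
  by (simp add: ZFact_defs ZMod_def)

lemma ZFact_pow: "ZMod m a [^]\<^bsub>ZFact m\<^esub> (r :: nat) = ZMod m (a ^ r)"
proof -
  interpret cring "ZFact m"
    by (rule ZFact_is_cring)
  show ?thesis
    by (induction r) (simp_all add: ZFact_one_class ZFact_mult mult.commute)
qed

lemma ZMod_eq_iff_cong: "ZMod m a = ZMod m b \<longleftrightarrow> [a = b] (mod m)"
  by (simp add: ZMod_eq_mod cong_def)

lemma ZMod_unit_iff: "ZMod m a \<in> Units (ZFact m) \<longleftrightarrow> coprime a m"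
proof -
  have "ZMod m a \<in> Units (ZFact m) \<longleftrightarrow> (\<exists>b. [a * b = 1] (mod m))"
    by (auto simp: Units_def ZFact_carrier ZFact_mult ZFact_one_class ZMod_eq_iff_cong
        mult.commute)
  also have "\<dots> \<longleftrightarrow> coprime a m"
    by (simp add: coprime_iff_invertible_int)
  finally show ?thesis .
qed

lemma Units_ZFact: "Units (ZFact m) = ZMod m ` {t. coprime t m}"
proof -
  have "Units (ZFact m) \<subseteq> range (ZMod m)"
    by (auto simp: Units_def ZFact_carrier)
  then show ?thesis
    by (auto simp: ZMod_unit_iff)
qed

lemma unit_powers_eq_image: "unit_powers r m = ZMod m ` power_residues r m"
proof -
  have "unit_powers r m = {ZMod m (t ^ r) | t. coprime t m}"
    unfolding unit_powers_def Units_ZFact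
    by (auto simp: ZFact_pow) (metis ZFact_pow imageI mem_Collect_eq)
  also have "\<dots> = ZMod m ` power_residues r m"
    by (auto simp: power_residues_def image_def simp flip: ZMod_mod)
  finally show ?thesis .
qed

lemma card_unit_powers: "card (unit_powers r m) = card (power_residues r m)"
proof -
  have "inj_on (ZMod m) (power_residues r m)"
    by (auto simp: inj_on_def power_residues_def ZMod_eq_mod)
  then show ?thesis
    by (simp add: unit_powers_eq_image card_image)
qed

section \<open>The solutions of the congruence\<close>

text \<open>The second component of a pair in \<open>P_r r N m\<close> is the quotient of \<open>N\<close> by the first.\<close>

lemma bij_betw_P_r:
  assumes "coprime N m"
  shows "bij_betw fst (P_r r N m) (unit_powers r m)"
proof -
  interpret cring "ZFact m"
    by (rule ZFact_is_cring)
  have N: "ZMod m N \<in> Units (ZFact m)"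
    using assms by (simp add: ZMod_unit_iff)
  have powers: "unit_powers r m \<subseteq> Units (ZFact m)"
    by (auto simp: unit_powers_def Units_ZFact ZFact_pow)
  have "inj_on fst (P_r r N m)"
  proof (rule inj_onI)
    fix z w
    assume "z \<in> P_r r N m" "w \<in> P_r r N m" "fst z = fst w"
    then obtain x y y' where "z = (x, y)" "w = (x, y')"
      and "x \<in> Units (ZFact m)" "y \<in> Units (ZFact m)" "y' \<in> Units (ZFact m)"
      and "x \<otimes>\<^bsub>ZFact m\<^esub> y = x \<otimes>\<^bsub>ZFact m\<^esub> y'"
      by (cases z; cases w) (auto simp: P_r_def)
    then show "z = w"
      by (simp add: Units_l_cancel Units_closed)
  qed
  moreover have "fst ` P_r r N m = unit_powers r m"
  proof (intro equalityI subsetI)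
    fix x
    assume "x \<in> unit_powers r m"
    moreover have x: "x \<in> Units (ZFact m)"
      using calculation powers by blast
    define y where "y = inv\<^bsub>ZFact m\<^esub> x \<otimes>\<^bsub>ZFact m\<^esub> ZMod m N"
    have "y \<in> Units (ZFact m)"
      using x N by (simp add: y_def)
    moreover have "x \<otimes>\<^bsub>ZFact m\<^esub> y = ZMod m N"
      using x N by (simp add: y_def Units_closed flip: m_assoc)
    ultimately have "(x, y) \<in> P_r r N m"
      using x by (simp add: P_r_def)
    then show "x \<in> fst ` P_r r N m"
      by force
  qed (auto simp: P_r_def)
  ultimately show ?thesis
    by (simp add: bij_betw_def)
qed

lemma finite_P_r:
  assumes "coprime N m" and "m > 0"
  shows "finite (P_r r N m)"
  using bij_betw_finite[OF bij_betw_P_r[OF assms(1)]] finite_power_residues[OF assms(2)]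
  by (simp add: unit_powers_eq_image)

lemma card_P_r:
  assumes "coprime N m"
  shows "card (P_r r N m) = card (power_residues r m)"
  using bij_betw_same_card[OF bij_betw_P_r[OF assms]] by (simp add: card_unit_powers)

lemma factorization_in_P_r:
  assumes "coprime (u ^ r * v) m" and "r > 0"
  shows "(ZMod m (u ^ r), ZMod m v) \<in> P_r r (u ^ r * v) m"
proof -
  have "coprime (u ^ r) m" "coprime v m"
    using assms(1) by simp_all
  moreover have "coprime u m"
    using \<open>coprime (u ^ r) m\<close> assms(2) by simp
  then have "ZMod m (u ^ r) \<in> unit_powers r m"
    by (auto simp: unit_powers_def Units_ZFact simp flip: ZFact_pow)
  ultimately show ?thesis
    by (simp add: P_r_def ZMod_unit_iff ZFact_mult)
qed

theorem corollary9p3: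
  shows "\<exists>C::real. C > 0 \<and>
    (\<forall>(r::nat) (N::int) (n::nat) (l::nat \<Rightarrow> int) (m::int).
      r \<ge> 2 \<longrightarrow>
      m = (\<Prod>i=1..n. l i) \<longrightarrow>
      inj_on l {1..n} \<longrightarrow>
      (\<forall>i\<in>{1..n}. Factorial_Ring.prime (l i) \<and> [l i = 1] (mod int r) \<and> \<not> l i dvd N) \<longrightarrow>
      finite (P_r r N m) \<and>
      real (card (P_r r N m)) = (\<Prod>i=1..n. real_of_int (l i - 1) / real r) \<and>
      \<bar>\<Prod>i=1..n. real_of_int (l i - 1) / real r\<bar> \<le> C * (real_of_int m / real r ^ n) \<and>
      (\<forall>u v::int. N = u ^ r * v \<longrightarrow> (ZMod m (u ^ r), ZMod m v) \<in> P_r r N m))"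
proof (intro exI[of _ "1 :: real"] conjI allI impI)
  fix r :: nat and N :: int and n :: nat and l :: "nat \<Rightarrow> int" and m :: int
  assume r: "r \<ge> 2" and m: "m = (\<Prod>i=1..n. l i)" and inj: "inj_on l {1..n}"
    and l: "\<forall>i\<in>{1..n}. Factorial_Ring.prime (l i) \<and> [l i = 1] (mod int r) \<and> \<not> l i dvd N"
  have l_gt_1: "l i > 1" if "i \<in> {1..n}" for i
    using l that by (simp add: prime_gt_1_int)
  have "m > 0"
    unfolding m by (rule prod_pos) (use l_gt_1 in force)
  have N: "coprime N m"
    unfolding m using l
    by (intro prod_coprime_right) (metis prime_imp_coprime coprime_commute)
  show "finite (P_r r N m)"
    using N \<open>m > 0\<close> by (rule finite_P_r)
  have "coprime (l i) (l j)" if "i \<in> {1..n}" "j \<in> {1..n}" "i \<noteq> j" for i j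
    using l inj that by (intro primes_coprime) (auto dest: inj_onD)
  then have "card (power_residues r m) = (\<Prod>i=1..n. card (power_residues r (l i)))"
    unfolding m by (intro card_power_residues_prod) auto
  moreover have "real (card (power_residues r (l i))) = real_of_int (l i - 1) / real r"
    if "i \<in> {1..n}" for i
  proof -
    have "int r * int (card (power_residues r (l i))) = l i - 1"
      using l that by (intro card_power_residues_prime) auto
    then have "real r * real (card (power_residues r (l i))) = real_of_int (l i - 1)"
      by (metis of_int_mult of_int_of_nat_eq)
    then show ?thesis
      using r by (simp add: field_simps)
  qed
  ultimately show "real (card (P_r r N m)) = (\<Prod>i=1..n. real_of_int (l i - 1) / real r)"
    by (simp add: card_P_r[OF N])
  have "\<bar>\<Prod>i=1..n. real_of_int (l i - 1) / real r\<bar>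
      = (\<Prod>i=1..n. \<bar>real_of_int (l i - 1) / real r\<bar>)"
    by (rule abs_prod)
  also have "\<dots> \<le> (\<Prod>i=1..n. real_of_int (l i) / real r)"
  proof (rule prod_mono)
    fix i
    assume "i \<in> {1..n}"
    then show "0 \<le> \<bar>real_of_int (l i - 1) / real r\<bar> \<and>
        \<bar>real_of_int (l i - 1) / real r\<bar> \<le> real_of_int (l i) / real r"
      using l_gt_1[of i] by (auto simp: divide_right_mono)
  qed
  also have "\<dots> = 1 * (real_of_int m / real r ^ n)"
    by (simp add: m prod_dividef)
  finally show "\<bar>\<Prod>i=1..n. real_of_int (l i - 1) / real r\<bar>
      \<le> 1 * (real_of_int m / real r ^ n)" .
  show "(ZMod m (u ^ r), ZMod m v) \<in> P_r r N m" if "N = u ^ r * v" for u v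
    using factorization_in_P_r[of u r v m] N r that by simp
qed simp

end
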